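(* Let $K\ge 2$ be an integer and let $(h_n)_{n\in\mathbb Z}$ be a sequence of monic palindromic polynomials in $\mathbb Q[x]$ with $h_n=h_{n-K}$ for all $n\in\mathbb Z$. Let $\mathcal F_K(Y_1,\dots,Y_K)$ and its elements $a_n,b_n,Y_n$ ($n\in\mathbb Z$) be as defined in the context. Then for every $n\in\mathbb Z$, $Y_n$ is a noncommutative Laurent polynomial in $Y_1,\dots,Y_K$; that is, $Y_n$ lies in the $\mathbb Q$-subalgebra generated by $a_1^{\pm1},\dots,a_K^{\pm1},b_1^{\pm1},\dots,b_K^{\pm1}$ and $Y_1^{\pm1},\dots,Y_K^{\pm1}$.
   Context: A polynomial $h(x)=\sum_{i=0}^{d}P_i x^i\in\mathbb Q[x]$ of degree $d\ge 0$ is monic palindromic if $P_d=1$ and $P_i=P_{d-i}$ for all $0\le i\le d$ (so $P_0=P_d=1$). All algebras are associative and unital, not necessarily commutative. Fix $K\ge2$ and monic palindromic $h_n\in\mathbb Q[x]$ ($n\in\mathbb Z$) with $h_n=h_{n-K}$. $\mathcal F_K(Y_1,\dots,Y_K)$ is the $\mathbb Q$-algebra generated by invertible elements $a_1,\dots,a_K,b_1,\dots,b_K$ and invertible elements $Y_n$ ($n\in\mathbb Z$), subject only to the relation $$Y_1a_1Y_2a_2\cdots Y_Ka_K=b_KY_Kb_{K-1}Y_{K-1}\cdots b_1Y_1$$ and the recursion $$Y_{n+K}Y_n=h_n\left(a_nY_{n+1}a_{n+1}Y_{n+2}\cdots Y_{n+K-1}a_{n+K-1}\right)\qquad(n\in\mathbb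 Z),$$ where $a_n,b_n$ for all $n\in\mathbb Z$ are defined from $a_1,\dots,a_K,b_1,\dots,b_K$ by $a_{n+K}=b_n^{-1}$ and $b_{n+K}=a_n^{-1}$. Thus $Y_1,\dots,Y_K$ are the initial variables, and the recursion determines every other $Y_n$ from them. *)

theory Defs
  imports
    "HOL-Algebra.Generated_Rings"
    "HOL-Computational_Algebra.Polynomial"
    "HOL-Library.Poly_Mapping"
begin

definition monic_palindromic :: "rat poly \<Rightarrow> bool" where
  "monic_palindromic p \<longleftrightarrow>
     Polynomial.lead_coeff p = 1 \<and>
     (\<forall>i\<le>Polynomial.degree p. Polynomial.coeff p i = Polynomial.coeff p (Polynomial.degree p - i))"


section \<open>Free associative algebras over the rationals\<close>

text \<open>
  Words form the free monoid, written additively, so that finitely supported functions from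
  words to the rationals, with the convolution product of \<^theory>\<open>HOL-Library.Poly_Mapping\<close>,
  are the noncommutative polynomials.
\<close>

datatype 'x word = Word (letters: "'x list")

instantiation word :: (type) monoid_add
begin
definition "0 = Word []"
definition "u + v = Word (letters u @ letters v)"
instance by standard (auto simp: zero_word_def plus_word_def)
end

type_synonym 'x ncpoly = "'x word \<Rightarrow>\<^sub>0 rat"

definition nc_var :: "'x \<Rightarrow> 'x ncpoly" where
  "nc_var x = Poly_Mapping.single (Word [x]) 1"

definition nc_const :: "rat \<Rightarrow> 'x ncpoly" where
  "nc_const c = Poly_Mapping.single 0 c"

definition nc_eval :: "rat poly \<Rightarrow> 'x ncpoly \<Rightarrow> 'x ncpoly" where
  "nc_eval p z = (\<Sum>i\<le>Polynomial.degree p. nc_const (Polynomial.coeff p i) * z ^ i)"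

definition free_algebra :: "'x set \<Rightarrow> 'x ncpoly ring" where
  "free_algebra X =
     \<lparr>carrier = {p. \<forall>w\<in>Poly_Mapping.keys p. set (letters w) \<subseteq> X},
      monoid.mult = (*), one = 1, zero = 0, add = (+)\<rparr>"


section \<open>The algebra presented by the generators and relations\<close>

datatype gen = GenA int | GenB int | GenY int

text \<open>Each generator comes with a second letter, which the relations make its inverse.\<close>

datatype letter = Pos gen | Neg gen

fun flip :: "letter \<Rightarrow> letter" where
  "flip (Pos g) = Neg g"
| "flip (Neg g) = Pos g"

definition gens :: "nat \<Rightarrow> gen set" where
  "gens K = GenA ` {1..int K} \<union> GenB ` {1..int K} \<union> range GenY"

definition alphabet :: "nat \<Rightarrow> letter set" where
  "alphabet K = Pos ` gens K \<union> Neg ` gens K"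

text \<open>
  The letters standing for \<open>a\<^sub>n\<close> and \<open>b\<^sub>n\<close> with arbitrary integer \<open>n\<close>. Solving the rules
  \<open>a\<^sub>n\<^sub>+\<^sub>K = b\<^sub>n\<^sup>-\<^sup>1\<close> and \<open>b\<^sub>n\<^sub>+\<^sub>K = a\<^sub>n\<^sup>-\<^sup>1\<close>: write \<open>n = r + q K\<close> with \<open>1 \<le> r \<le> K\<close>; then \<open>a\<^sub>n\<close> is
  \<open>a\<^sub>r\<close> for even \<open>q\<close> and \<open>b\<^sub>r\<^sup>-\<^sup>1\<close> for odd \<open>q\<close>, and symmetrically for \<open>b\<^sub>n\<close>. The lemmas
  \<open>letter_init\<close> and \<open>letter_shift\<close> below state the defining properties.
\<close>

definition a_letter :: "nat \<Rightarrow> int \<Rightarrow> letter" where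
  "a_letter K n =
     (let q = (n - 1) div int K; r = (n - 1) mod int K + 1
      in if even q then Pos (GenA r) else Neg (GenB r))"

definition b_letter :: "nat \<Rightarrow> int \<Rightarrow> letter" where
  "b_letter K n =
     (let q = (n - 1) div int K; r = (n - 1) mod int K + 1
      in if even q then Pos (GenB r) else Neg (GenA r))"

definition a_var :: "nat \<Rightarrow> int \<Rightarrow> letter ncpoly" where
  "a_var K n = nc_var (a_letter K n)"

definition b_var :: "nat \<Rightarrow> int \<Rightarrow> letter ncpoly" where
  "b_var K n = nc_var (b_letter K n)"

definition Y_var :: "int \<Rightarrow> letter ncpoly" where
  "Y_var n = nc_var (Pos (GenY n))"

text \<open>Left-hand side minus right-hand side of each relation.\<close>

definition inverse_rels :: "nat \<Rightarrow> letter ncpoly set" where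
  "inverse_rels K = {nc_var x * nc_var (flip x) - 1 | x. x \<in> alphabet K}"

definition exchange_rel :: "nat \<Rightarrow> letter ncpoly" where
  "exchange_rel K =
     prod_list (map (\<lambda>j. Y_var j * a_var K j) [1..int K]) -
     prod_list (map (\<lambda>j. b_var K j * Y_var j) (rev [1..int K]))"

definition recursion_rel :: "nat \<Rightarrow> (int \<Rightarrow> rat poly) \<Rightarrow> int \<Rightarrow> letter ncpoly" where
  "recursion_rel K h n =
     Y_var (n + int K) * Y_var n -
     nc_eval (h n)
       (a_var K n * prod_list (map (\<lambda>j. Y_var j * a_var K j) [n + 1..n + int K - 1]))"

definition F_ideal :: "nat \<Rightarrow> (int \<Rightarrow> rat poly) \<Rightarrow> letter ncpoly set" where
  "F_ideal K h =
     Idl\<^bsub>free_algebra (alphabet K)\<^esub>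
       (inverse_rels K \<union> {exchange_rel K} \<union> range (recursion_rel K h))"

definition F_alg :: "nat \<Rightarrow> (int \<Rightarrow> rat poly) \<Rightarrow> letter ncpoly set ring" where
  "F_alg K h = free_algebra (alphabet K) Quot F_ideal K h"

definition F_class :: "nat \<Rightarrow> (int \<Rightarrow> rat poly) \<Rightarrow> letter ncpoly \<Rightarrow> letter ncpoly set" where
  "F_class K h p = F_ideal K h +>\<^bsub>free_algebra (alphabet K)\<^esub> p"

definition F_a :: "nat \<Rightarrow> (int \<Rightarrow> rat poly) \<Rightarrow> int \<Rightarrow> letter ncpoly set" where
  "F_a K h n = F_class K h (a_var K n)"

definition F_b :: "nat \<Rightarrow> (int \<Rightarrow> rat poly) \<Rightarrow> int \<Rightarrow> letter ncpoly set" where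
  "F_b K h n = F_class K h (b_var K n)"

definition F_Y :: "nat \<Rightarrow> (int \<Rightarrow> rat poly) \<Rightarrow> int \<Rightarrow> letter ncpoly set" where
  "F_Y K h n = F_class K h (Y_var n)"

text \<open>
  The subalgebra over the rationals generated by \<open>S\<close> is the subring generated by \<open>S\<close> together
  with all scalars.
\<close>

definition F_subalgebra ::
    "nat \<Rightarrow> (int \<Rightarrow> rat poly) \<Rightarrow> letter ncpoly set set \<Rightarrow> letter ncpoly set set" where
  "F_subalgebra K h S = generate_ring (F_alg K h) (range (\<lambda>c. F_class K h (nc_const c)) \<union> S)"


section \<open>Basic facts\<close>

lemma letter_init:
  assumes "1 \<le> i" "i \<le> int K"
  shows "a_letter K i = Pos (GenA i)" "b_letter K i = Pos (GenB i)"
proof -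
  have "(i - 1) div int K = 0" "(i - 1) mod int K = i - 1"
    using assms by (auto intro: div_pos_pos_trivial mod_pos_pos_trivial)
  then show "a_letter K i = Pos (GenA i)" "b_letter K i = Pos (GenB i)"
    by (simp_all add: a_letter_def b_letter_def)
qed

lemma letter_shift:
  assumes "K > 0"
  shows "a_letter K (n + int K) = flip (b_letter K n)"
    and "b_letter K (n + int K) = flip (a_letter K n)"
proof -
  have "(n + int K - 1) div int K = (n - 1) div int K + 1"
       "(n + int K - 1) mod int K = (n - 1) mod int K"
    using assms div_add_self2[of "int K" "n - 1"] mod_add_self2[of "n - 1" "int K"]
    by (simp_all add: algebra_simps)
  then show "a_letter K (n + int K) = flip (b_letter K n)"
    and "b_letter K (n + int K) = flip (a_letter K n)"
    by (simp_all add: a_letter_def b_letter_def Let_def)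
qed

lemma flip_alphabet: "x \<in> alphabet K \<Longrightarrow> flip x \<in> alphabet K"
  by (auto simp: alphabet_def)

lemma flip_flip [simp]: "flip (flip x) = x"
  by (cases x) auto

lemma letter_in_alphabet:
  assumes "K > 0"
  shows "a_letter K n \<in> alphabet K" "b_letter K n \<in> alphabet K"
proof -
  have "(n - 1) mod int K + 1 \<in> {1..int K}"
    using assms pos_mod_bound[of "int K" "n - 1"] by (simp add: add1_zle_eq)
  then show "a_letter K n \<in> alphabet K" "b_letter K n \<in> alphabet K"
    by (simp_all add: a_letter_def b_letter_def Let_def alphabet_def gens_def)
qed

lemma free_algebra_ring: "ring (free_algebra X)"
proof -
  let ?C = "{p :: 'a ncpoly. \<forall>w\<in>Poly_Mapping.keys p. set (letters w) \<subseteq> X}"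
  have add: "p + q \<in> ?C" if "p \<in> ?C" "q \<in> ?C" for p q
    using that Poly_Mapping.keys_add[of p q] by blast
  have mult: "p * q \<in> ?C" if "p \<in> ?C" "q \<in> ?C" for p q
    using that Poly_Mapping.keys_mult[of p q] by (fastforce simp: plus_word_def)
  have one: "1 \<in> ?C"
    by (simp add: zero_word_def flip: single_one)
  have neg: "- p \<in> ?C" if "p \<in> ?C" for p
    using that by simp
  have inv: "\<exists>q\<in>?C. q + p = 0" if "p \<in> ?C" for p
    using neg[OF that] by (intro bexI[of _ "- p"]) simp_all
  have zero: "0 \<in> ?C" by simp
  have simps: "carrier (free_algebra X) = ?C" "\<zero>\<^bsub>free_algebra X\<^esub> = 0"
      "\<one>\<^bsub>free_algebra X\<^esub> = 1" "x \<oplus>\<^bsub>free_algebra X\<^esub> y = x + y" "x \<otimes>\<^bsub>free_algebra X\<^esub> y = x * y" for x y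
    by (simp_all add: free_algebra_def)
  have "abelian_group (free_algebra X)"
    by (rule abelian_groupI; unfold simps)
      (rule zero add.assoc add.commute add_0_left | erule (1) add | erule inv)+
  moreover have "monoid (free_algebra X)"
    by (rule monoidI; unfold simps) (rule one mult.assoc mult_1_left mult_1_right | erule (1) mult)+
  ultimately show ?thesis
    by (rule ringI; unfold simps) (rule distrib_left distrib_right)+
qed

lemma carrier_closed:
  "1 \<in> carrier (free_algebra X)"
  "p \<in> carrier (free_algebra X) \<Longrightarrow> q \<in> carrier (free_algebra X) \<Longrightarrow>
    p + q \<in> carrier (free_algebra X)"
  "p \<in> carrier (free_algebra X) \<Longrightarrow> q \<in> carrier (free_algebra X) \<Longrightarrow>
    p - q \<in> carrier (free_algebra X)"
  "p \<in> carrier (free_algebra X) \<Longrightarrow> q \<in> carrier (free_algebra X) \<Longrightarrow>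
    p * q \<in> carrier (free_algebra X)"
  "nc_const c \<in> carrier (free_algebra X)"
  "x \<in> X \<Longrightarrow> nc_var x \<in> carrier (free_algebra X)"
proof -
  interpret ring "free_algebra X" by (rule free_algebra_ring)
  have op: "x \<oplus>\<^bsub>free_algebra X\<^esub> y = x + y" "x \<otimes>\<^bsub>free_algebra X\<^esub> y = x * y"
           "\<one>\<^bsub>free_algebra X\<^esub> = 1" for x y
    by (simp_all add: free_algebra_def)
  have neg: "- q \<in> carrier (free_algebra X)" if "q \<in> carrier (free_algebra X)" for q
    using that by (simp add: free_algebra_def)
  show "1 \<in> carrier (free_algebra X)" using one_closed by (simp add: op)
  show add: "p + q \<in> carrier (free_algebra X)"
    if "p \<in> carrier (free_algebra X)" "q \<in> carrier (free_algebra X)" for p q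
    using add.m_closed[OF that] by (simp add: op)
  show "p - q \<in> carrier (free_algebra X)"
    if "p \<in> carrier (free_algebra X)" "q \<in> carrier (free_algebra X)"
    using add[OF that(1) neg[OF that(2)]] by simp
  show "p * q \<in> carrier (free_algebra X)"
    if "p \<in> carrier (free_algebra X)" "q \<in> carrier (free_algebra X)"
    using m_closed[OF that] by (simp add: op)
  show "nc_const c \<in> carrier (free_algebra X)"
    by (simp add: free_algebra_def nc_const_def zero_word_def)
  show "nc_var x \<in> carrier (free_algebra X)" if "x \<in> X"
    using that by (simp add: free_algebra_def nc_var_def)
qed

lemma prod_list_closed:
  assumes "\<And>i. i \<in> set xs \<Longrightarrow> f i \<in> carrier (free_algebra X)"
  shows "prod_list (map f xs) \<in> carrier (free_algebra X)"
  using assms by (induction xs) (auto intro: carrier_closed)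

lemma nc_eval_closed:
  assumes "z \<in> carrier (free_algebra X)"
  shows "nc_eval p z \<in> carrier (free_algebra X)"
proof -
  have "z ^ i \<in> carrier (free_algebra X)" for i
    using assms by (induction i) (auto intro: carrier_closed)
  then have "(\<Sum>i\<le>(m::nat). nc_const (c i) * z ^ i) \<in> carrier (free_algebra X)" for m c
    by (induction m) (simp_all add: carrier_closed del: power_Suc)
  then show ?thesis by (simp add: nc_eval_def)
qed

lemma var_closed:
  assumes "K > 0"
  shows "a_var K n \<in> carrier (free_algebra (alphabet K))"
    "b_var K n \<in> carrier (free_algebra (alphabet K))"
    "Y_var n \<in> carrier (free_algebra (alphabet K))"
proof -
  have "Pos (GenY n) \<in> alphabet K" by (simp add: alphabet_def gens_def)
  then show "a_var K n \<in> carrier (free_algebra (alphabet K))"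
    "b_var K n \<in> carrier (free_algebra (alphabet K))"
    "Y_var n \<in> carrier (free_algebra (alphabet K))"
    unfolding a_var_def b_var_def Y_var_def
    by (intro carrier_closed(6) letter_in_alphabet[OF assms]; assumption)+
qed

lemma relations_closed:
  assumes "K > 0"
  shows "inverse_rels K \<union> {exchange_rel K} \<union> range (recursion_rel K h)
    \<subseteq> carrier (free_algebra (alphabet K))"
proof -
  note closed = carrier_closed prod_list_closed nc_eval_closed var_closed[OF assms] flip_alphabet
  have "inverse_rels K \<subseteq> carrier (free_algebra (alphabet K))"
    unfolding inverse_rels_def by (auto intro: closed)
  moreover have "exchange_rel K \<in> carrier (free_algebra (alphabet K))"
    unfolding exchange_rel_def by (intro closed)
  moreover have "recursion_rel K h n \<in> carrier (free_algebra (alphabet K))" for n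
    unfolding recursion_rel_def by (intro closed)
  ultimately show ?thesis by blast
qed

lemma F_ideal_ideal: "K > 0 \<Longrightarrow> ideal (F_ideal K h) (free_algebra (alphabet K))"
  unfolding F_ideal_def
  by (intro ring.genideal_ideal free_algebra_ring relations_closed)

lemma F_alg_ring: "K > 0 \<Longrightarrow> ring (F_alg K h)"
  unfolding F_alg_def by (intro ideal.quotient_is_ring F_ideal_ideal)

lemma F_class_hom: "K > 0 \<Longrightarrow> F_class K h \<in> ring_hom (free_algebra (alphabet K)) (F_alg K h)"
  using ideal.rcos_ring_hom[OF F_ideal_ideal] unfolding F_alg_def F_class_def .

lemma F_class_eqI:
  assumes "K > 0" "p - q \<in> inverse_rels K \<union> {exchange_rel K} \<union> range (recursion_rel K h)"
    "p \<in> carrier (free_algebra (alphabet K))" "q \<in> carrier (free_algebra (alphabet K))"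
  shows "F_class K h p = F_class K h q"
proof -
  interpret ideal "F_ideal K h" "free_algebra (alphabet K)" by (rule F_ideal_ideal[OF assms(1)])
  have i: "p - q \<in> F_ideal K h"
    using assms(2) genideal_self[OF relations_closed[OF assms(1), of h]]
    unfolding F_ideal_def by blast
  have "p = (p - q) \<oplus>\<^bsub>free_algebra (alphabet K)\<^esub> q"
    by (simp add: free_algebra_def)
  then have "p \<in> F_class K h q"
    using i unfolding F_class_def a_r_coset_def' by blast
  then show ?thesis
    unfolding F_class_def by (rule a_repr_independence[OF _ assms(4) a_subgroup, symmetric])
qed

lemma F_exchange:
  assumes "K > 0"
  shows "F_class K h (prod_list (map (\<lambda>j. Y_var j * a_var K j) [1..int K])) =
    F_class K h (prod_list (map (\<lambda>j. b_var K j * Y_var j) (rev [1..int K])))"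
  by (rule F_class_eqI[OF assms])
    (simp add: exchange_rel_def, (intro prod_list_closed carrier_closed var_closed assms)+)

lemma F_recursion:
  assumes "K > 0"
  shows "F_Y K h (n + int K) \<otimes>\<^bsub>F_alg K h\<^esub> F_Y K h n =
    F_class K h (nc_eval (h n)
      (a_var K n * prod_list (map (\<lambda>j. Y_var j * a_var K j) [n + 1..n + int K - 1])))"
proof -
  have "F_Y K h (n + int K) \<otimes>\<^bsub>F_alg K h\<^esub> F_Y K h n = F_class K h (Y_var (n + int K) * Y_var n)"
    using ring_hom_mult[OF F_class_hom[OF assms, of h] var_closed(3)[OF assms, of "n + int K"]
        var_closed(3)[OF assms, of n]]
    by (simp add: F_Y_def free_algebra_def)
  also have "\<dots> = F_class K h (nc_eval (h n)
      (a_var K n * prod_list (map (\<lambda>j. Y_var j * a_var K j) [n + 1..n + int K - 1])))"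
    by (rule F_class_eqI[OF assms], fold recursion_rel_def)
      (simp, (intro prod_list_closed carrier_closed nc_eval_closed var_closed assms)+)
  finally show ?thesis .
qed

lemma F_inverse:
  assumes "K > 0" "x \<in> alphabet K"
  shows "F_class K h (nc_var x) \<in> Units (F_alg K h)"
    and "inv\<^bsub>F_alg K h\<^esub> F_class K h (nc_var x) = F_class K h (nc_var (flip x))"
proof -
  interpret ring "F_alg K h" by (rule F_alg_ring[OF assms(1)])
  have "F_class K h (nc_var y) \<otimes>\<^bsub>F_alg K h\<^esub> F_class K h (nc_var (flip y)) = \<one>\<^bsub>F_alg K h\<^esub>
      \<and> F_class K h (nc_var y) \<in> carrier (F_alg K h)"
    if y: "y \<in> alphabet K" for y
  proof -
    have c: "nc_var y \<in> carrier (free_algebra (alphabet K))"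
        "nc_var (flip y) \<in> carrier (free_algebra (alphabet K))"
      using y flip_alphabet by (auto intro: carrier_closed)
    have "F_class K h (nc_var y) \<otimes>\<^bsub>F_alg K h\<^esub> F_class K h (nc_var (flip y))
        = F_class K h (nc_var y * nc_var (flip y))"
      using ring_hom_mult[OF F_class_hom[OF assms(1), of h] c] by (simp add: free_algebra_def)
    also have "\<dots> = F_class K h 1"
      by (rule F_class_eqI[OF assms(1)])
        (use y c in \<open>auto simp: inverse_rels_def intro!: carrier_closed\<close>)
    also have "\<dots> = \<one>\<^bsub>F_alg K h\<^esub>"
      using ring_hom_one[OF F_class_hom[OF assms(1), of h]] by (simp add: free_algebra_def)
    finally show ?thesis
      using ring_hom_closed[OF F_class_hom[OF assms(1), of h] c(1)] by simp
  qed
  from this[OF assms(2)] this[OF flip_alphabet[OF assms(2)]]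
  have unit: "F_class K h (nc_var x) \<in> carrier (F_alg K h)"
      "F_class K h (nc_var (flip x)) \<in> carrier (F_alg K h)"
      "F_class K h (nc_var x) \<otimes>\<^bsub>F_alg K h\<^esub> F_class K h (nc_var (flip x)) = \<one>\<^bsub>F_alg K h\<^esub>"
      "F_class K h (nc_var (flip x)) \<otimes>\<^bsub>F_alg K h\<^esub> F_class K h (nc_var x) = \<one>\<^bsub>F_alg K h\<^esub>"
    by simp_all
  show "F_class K h (nc_var x) \<in> Units (F_alg K h)"
    unfolding Units_def using unit by blast
  show "inv\<^bsub>F_alg K h\<^esub> F_class K h (nc_var x) = F_class K h (nc_var (flip x))"
    by (rule inv_char[OF unit])
qed

lemma F_shift:
  assumes "K > 0"
  shows "F_a K h (n + int K) = inv\<^bsub>F_alg K h\<^esub> F_b K h n"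
    and "F_b K h (n + int K) = inv\<^bsub>F_alg K h\<^esub> F_a K h n"
  using F_inverse(2)[OF assms] letter_in_alphabet[OF assms] letter_shift[OF assms]
  by (simp_all add: F_a_def F_b_def a_var_def b_var_def)

end

theory Submission
  imports Defs
begin

text \<open>
  Write \<open>X\<^sub>n = a\<^sub>n Y\<^sub>n\<^sub>+\<^sub>1 a\<^sub>n\<^sub>+\<^sub>1 \<dots> Y\<^sub>n\<^sub>+\<^sub>K\<^sub>-\<^sub>1 a\<^sub>n\<^sub>+\<^sub>K\<^sub>-\<^sub>1\<close> and \<open>Z\<^sub>n = b\<^sub>n\<^sub>+\<^sub>K\<^sub>-\<^sub>1 Y\<^sub>n\<^sub>+\<^sub>K\<^sub>-\<^sub>1 \<dots> b\<^sub>n\<^sub>+\<^sub>1 Y\<^sub>n\<^sub>+\<^sub>1 b\<^sub>n\<close>.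
  The recursion propagates the exchange relation \<open>Y\<^sub>n X\<^sub>n = Z\<^sub>n Y\<^sub>n\<close> from one \<open>n\<close> to all \<open>n\<close>,
  and then \<open>X\<^sub>n Y\<^sub>n\<^sub>+\<^sub>K = Y\<^sub>n\<^sub>+\<^sub>K Z\<^sub>n\<close> and \<open>Y\<^sub>n Y\<^sub>n\<^sub>+\<^sub>K = h\<^sub>n(Z\<^sub>n)\<close>.

  Let \<open>B\<close> be the subalgebra generated by all \<open>a\<^sub>i\<close>, \<open>b\<^sub>i\<close> and by \<open>Y\<^sub>n, \<dots>, Y\<^sub>n\<^sub>+\<^sub>2\<^sub>K\<^sub>-\<^sub>1\<close>, and work
  modulo the left ideal \<open>B Y\<^sub>n\<^sub>+\<^sub>K\<close>. Collapsing the product \<open>X\<^sub>n\<^sub>+\<^sub>K Z\<^sub>n\<close> from the inside, where each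
  \<open>Y\<^sub>n\<^sub>+\<^sub>K\<^sub>+\<^sub>j Y\<^sub>n\<^sub>+\<^sub>j\<close> is \<open>1\<close> plus a multiple of \<open>X\<^sub>n\<^sub>+\<^sub>j\<close>, gives \<open>X\<^sub>n\<^sub>+\<^sub>K Z\<^sub>n \<equiv> 1\<close>. As \<open>h\<^sub>n\<close> is palindromic
  of some degree \<open>d\<close>, \<open>Y\<^sub>n\<^sub>+\<^sub>2\<^sub>K Y\<^sub>n\<^sub>+\<^sub>K = h\<^sub>n(X\<^sub>n\<^sub>+\<^sub>K) \<equiv> X\<^sub>n\<^sub>+\<^sub>K\<^sup>d h\<^sub>n(Z\<^sub>n) = X\<^sub>n\<^sub>+\<^sub>K\<^sup>d Y\<^sub>n Y\<^sub>n\<^sub>+\<^sub>K \<equiv> 0\<close>. Hence \<open>Y\<^sub>n\<^sub>+\<^sub>2\<^sub>K\<close>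
  lies in \<open>B\<close>, with no inverse of any \<open>Y\<^sub>i\<close> involved, and induction covers all indices above \<open>2K\<close>.
  Negative indices follow from the symmetry \<open>Y\<^sub>n \<mapsto> Y\<^sub>-\<^sub>n\<close>, \<open>a\<^sub>n \<mapsto> b\<^sub>-\<^sub>n\<^sub>-\<^sub>1\<close>, \<open>b\<^sub>n \<mapsto> a\<^sub>-\<^sub>n\<^sub>-\<^sub>1\<close>.
\<close>

section \<open>Polynomial evaluation in a noncommutative ring\<close>

lemma (in monoid) Units_r_cancel:
  assumes "u \<in> Units G" "x \<in> carrier G" "y \<in> carrier G"
  shows "x \<otimes> u = y \<otimes> u \<longleftrightarrow> x = y"
proof
  assume "x \<otimes> u = y \<otimes> u"
  then have "x \<otimes> u \<otimes> inv u = y \<otimes> u \<otimes> inv u" by simp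
  then show "x = y" using assms by (simp add: m_assoc Units_closed)
qed simp

locale scalar_ring = ring R for R (structure) +
  fixes \<kappa> :: "rat \<Rightarrow> 'a"
  assumes scalar_closed [simp, intro]: "\<kappa> c \<in> carrier R"
    and scalar_one [simp]: "\<kappa> 1 = \<one>"
    and scalar_central: "x \<in> carrier R \<Longrightarrow> \<kappa> c \<otimes> x = x \<otimes> \<kappa> c"
begin

definition peval :: "rat poly \<Rightarrow> 'a \<Rightarrow> 'a" where
  "peval p x = (\<Oplus>i\<in>{..degree p}. \<kappa> (coeff p i) \<otimes> x [^] i)"

lemma peval_closed [simp, intro]: "x \<in> carrier R \<Longrightarrow> peval p x \<in> carrier R"
  unfolding peval_def by (intro finsum_closed) auto

lemma pow_intertwine:
  assumes "x \<in> carrier R" "y \<in> carrier R" "z \<in> carrier R" "y \<otimes> x = z \<otimes> y"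
  shows "y \<otimes> x [^] (i::nat) = z [^] i \<otimes> y"
proof (induction i)
  case (Suc i)
  have "y \<otimes> x [^] Suc i = (y \<otimes> x [^] i) \<otimes> x"
    using assms(1,2) by (simp add: m_assoc)
  also have "\<dots> = z [^] i \<otimes> (y \<otimes> x)"
    unfolding Suc.IH using assms(1-3) by (simp add: m_assoc)
  also have "\<dots> = z [^] Suc i \<otimes> y"
    unfolding assms(4) using assms(2,3) by (simp add: m_assoc)
  finally show ?case .
qed (use assms in simp)

text \<open>Intertwining passes to powers and, scalars being central, to polynomials. With
  \<open>y = Y n\<close> it turns h_n(X_n) into h_n(Z_n); with x = y = z it says that x commutes
  with p(x).\<close>

lemma peval_intertwine:
  assumes "x \<in> carrier R" "y \<in> carrier R" "z \<in> carrier R" "y \<otimes> x = z \<otimes> y"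
  shows "y \<otimes> peval p x = peval p z \<otimes> y"
proof -
  have "y \<otimes> (\<kappa> c \<otimes> x [^] i) = \<kappa> c \<otimes> z [^] i \<otimes> y" for c and i :: nat
  proof -
    have "y \<otimes> (\<kappa> c \<otimes> x [^] i) = (y \<otimes> \<kappa> c) \<otimes> x [^] i"
      using assms(1,2) by (simp add: m_assoc)
    also have "\<dots> = (\<kappa> c \<otimes> y) \<otimes> x [^] i"
      by (simp only: scalar_central[OF assms(2)])
    finally show ?thesis
      using assms by (simp add: pow_intertwine m_assoc)
  qed
  then show ?thesis
    unfolding peval_def using assms(1-3)
    by (simp add: finsum_rdistr finsum_ldistr Pi_def)
qed

end


section \<open>Congruence modulo a principal left ideal\<close>

locale scalar_subring = scalar_ring +
  fixes B
  assumes subring_B: "subring B R"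
    and scalar_B [simp, intro]: "\<kappa> c \<in> B"
begin

lemma B_carrier [simp]: "x \<in> B \<Longrightarrow> x \<in> carrier R"
  using subringE(1)[OF subring_B] by blast

lemma B_closed [simp, intro]:
  "\<one> \<in> B" "\<zero> \<in> B"
  "x \<in> B \<Longrightarrow> \<ominus> x \<in> B"
  "x \<in> B \<Longrightarrow> y \<in> B \<Longrightarrow> x \<otimes> y \<in> B"
  "x \<in> B \<Longrightarrow> y \<in> B \<Longrightarrow> x \<oplus> y \<in> B"
  using subringE[OF subring_B] by auto

lemma B_pow [simp, intro]: "x \<in> B \<Longrightarrow> x [^] (i::nat) \<in> B"
  by (induction i) auto

lemma B_finsum:
  fixes f :: "nat \<Rightarrow> 'a"
  shows "(\<And>i. f i \<in> B) \<Longrightarrow> (\<Oplus>i\<in>{..m}. f i) \<in> B"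
  by (induction m) (simp_all add: finsum_Suc Pi_def)

lemma peval_B [simp, intro]: "x \<in> B \<Longrightarrow> peval p x \<in> B"
  unfolding peval_def by (intro B_finsum) auto

text \<open>The multiplier is taken from \<open>B\<close>: over all of R the relation would be
  trivial whenever \<open>u\<close> is a unit, and \<open>r \<in> B\<close> is what finally puts a
  new Y_n into \<open>B\<close>. Congruences may be multiplied by \<open>B\<close> from the left,
  but in general not from the right.\<close>

definition lcong :: "'a \<Rightarrow> 'a \<Rightarrow> 'a \<Rightarrow> bool" where
  "lcong u x y \<longleftrightarrow> (\<exists>r\<in>B. x = y \<oplus> r \<otimes> u)"

lemma lcongI: "r \<in> B \<Longrightarrow> x = y \<oplus> r \<otimes> u \<Longrightarrow> lcong u x y"
  unfolding lcong_def by blast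

lemma lcong_refl: "u \<in> carrier R \<Longrightarrow> x \<in> carrier R \<Longrightarrow> lcong u x x"
  by (rule lcongI[of \<zero>]) auto

lemma lcong_sym:
  assumes "u \<in> carrier R" "y \<in> carrier R" "lcong u x y"
  shows "lcong u y x"
proof -
  obtain r where "r \<in> B" "x = y \<oplus> r \<otimes> u" using assms(3) unfolding lcong_def by blast
  then show ?thesis using assms(1,2)
    by (intro lcongI[of "\<ominus> r"]) (simp_all add: l_minus a_assoc r_neg)
qed

lemma lcong_trans:
  assumes "u \<in> carrier R" "z \<in> carrier R" "lcong u x y" "lcong u y z"
  shows "lcong u x z"
proof -
  obtain r s where "r \<in> B" "x = y \<oplus> r \<otimes> u" "s \<in> B" "y = z \<oplus> s \<otimes> u"
    using assms(3,4) unfolding lcong_def by blast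
  then show ?thesis using assms(1,2)
    by (intro lcongI[of "s \<oplus> r"]) (simp_all add: l_distr a_assoc)
qed

lemma lcong_add:
  assumes "u \<in> carrier R" "y \<in> carrier R" "y' \<in> carrier R" "lcong u x y" "lcong u x' y'"
  shows "lcong u (x \<oplus> x') (y \<oplus> y')"
proof -
  obtain r s where "r \<in> B" "x = y \<oplus> r \<otimes> u" "s \<in> B" "x' = y' \<oplus> s \<otimes> u"
    using assms(4,5) unfolding lcong_def by blast
  then show ?thesis using assms(1-3)
    by (intro lcongI[of "r \<oplus> s"]) (simp_all add: l_distr a_ac)
qed

lemma lcong_lmult:
  assumes "u \<in> carrier R" "y \<in> carrier R" "c \<in> B" "lcong u x y"
  shows "lcong u (c \<otimes> x) (c \<otimes> y)"
proof -
  obtain r where "r \<in> B" "x = y \<oplus> r \<otimes> u" using assms(4) unfolding lcong_def by blast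
  then show ?thesis using assms(1-3)
    by (intro lcongI[of "c \<otimes> r"]) (simp_all add: r_distr m_assoc)
qed

lemma lcong_finsum:
  fixes f g :: "nat \<Rightarrow> 'a"
  assumes "u \<in> carrier R" "\<And>i. f i \<in> carrier R" "\<And>i. g i \<in> carrier R"
    and "\<And>i. i \<le> m \<Longrightarrow> lcong u (f i) (g i)"
  shows "lcong u (\<Oplus>i\<in>{..m}. f i) (\<Oplus>i\<in>{..m}. g i)"
  using assms(4)
proof (induction m)
  case (Suc m)
  then show ?case using assms(1-3)
    by (simp add: finsum_Suc Pi_def) (intro lcong_add, auto)
qed (use assms(2,3) in \<open>simp add: Pi_def\<close>)

text \<open>The modulus is the argument itself, so every term except the constant one is a left
  multiple of it.\<close>

lemma peval_lcong_one:
  assumes "coeff p 0 = 1" "x \<in> B"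
  shows "lcong x (peval p x) \<one>"
proof -
  have "lcong x (\<Oplus>i\<in>{..m}. \<kappa> (coeff p i) \<otimes> x [^] i) \<one>" for m
  proof (induction m)
    case 0
    then show ?case using assms by (simp add: lcong_refl)
  next
    case (Suc m)
    have "lcong x (\<kappa> (coeff p (Suc m)) \<otimes> x [^] Suc m) \<zero>"
      using assms(2) by (intro lcongI[of "\<kappa> (coeff p (Suc m)) \<otimes> x [^] m"]) (simp_all add: m_assoc)
    from lcong_add[OF _ _ _ this Suc] show ?case
      using assms(2) by (simp add: finsum_Suc Pi_def)
  qed
  then show ?thesis unfolding peval_def .
qed

text \<open>Replacing the innermost \<open>w \<otimes> z\<close> by
  \<open>\<one> \<oplus> r \<otimes> u\<close> leaves an error ending in u z^m. The relation
  \<open>u \<otimes> z = x \<otimes> u\<close> turns this into x^m u, so the error stays a left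
  multiple of \<open>u\<close>.\<close>

lemma pow_lcong_one:
  assumes "w \<in> B" "z \<in> B" "x \<in> B" "u \<in> carrier R"
    and "u \<otimes> z = x \<otimes> u" "lcong u (w \<otimes> z) \<one>"
  shows "lcong u (w [^] (m::nat) \<otimes> z [^] m) \<one>"
proof (induction m)
  case 0
  then show ?case using assms by (simp add: lcong_refl)
next
  case (Suc m)
  obtain r where r: "r \<in> B" "w \<otimes> z = \<one> \<oplus> r \<otimes> u"
    using assms(6) unfolding lcong_def by blast
  have "w [^] Suc m \<otimes> z [^] Suc m = w [^] m \<otimes> (w \<otimes> z) \<otimes> z [^] m"
    using assms(1,2) by (simp add: m_assoc pow_intertwine[of z z z])
  also have "\<dots> = w [^] m \<otimes> z [^] m \<oplus> w [^] m \<otimes> r \<otimes> (u \<otimes> z [^] m)"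
    unfolding r(2) using assms(1-4) r(1) by (simp add: l_distr r_distr m_assoc)
  also have "\<dots> = w [^] m \<otimes> z [^] m \<oplus> (w [^] m \<otimes> r \<otimes> x [^] m) \<otimes> u"
    using assms r(1) by (simp add: pow_intertwine[of z u x] m_assoc)
  finally have "lcong u (w [^] Suc m \<otimes> z [^] Suc m) (w [^] m \<otimes> z [^] m)"
    using assms(1,3) r(1) by (intro lcongI) auto
  then show ?case
    using lcong_trans assms(4) Suc one_closed by blast
qed

text \<open>
  With \<open>z\<close> in the role of \<open>w\<^sup>-\<^sup>1\<close>, this is the palindromic symmetry \<open>p(w) = w\<^sup>d p(w\<^sup>-\<^sup>1)\<close>. Moving \<open>u\<close> past \<open>z\<close>
  keeps the error terms in the left ideal.
\<close>

lemma peval_lcong_reflect: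
  assumes "monic_palindromic p"
    and "w \<in> B" "z \<in> B" "x \<in> B" "u \<in> carrier R"
    and "u \<otimes> z = x \<otimes> u" "lcong u (w \<otimes> z) \<one>"
  shows "lcong u (peval p w) (w [^] degree p \<otimes> peval p z)"
proof -
  define d where "d = degree p"
  have step: "lcong u (\<kappa> (coeff p i) \<otimes> w [^] i) (w [^] d \<otimes> (\<kappa> (coeff p i) \<otimes> z [^] (d - i)))"
    if i: "i \<le> d" for i
  proof -
    \<comment> \<open>Split w^d as w^i w^(d-i) and pull the central scalar to the front; the inner
      pair w^(d-i) z^(d-i) is congruent to 1.\<close>
    have eq: "w [^] d \<otimes> (\<kappa> (coeff p i) \<otimes> z [^] (d - i))
        = \<kappa> (coeff p i) \<otimes> w [^] i \<otimes> (w [^] (d - i) \<otimes> z [^] (d - i))"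
    proof -
      have "w [^] d = w [^] i \<otimes> w [^] (d - i)"
        using assms(2) i by (simp add: nat_pow_mult)
      then have "w [^] d \<otimes> (\<kappa> (coeff p i) \<otimes> z [^] (d - i)) =
          (w [^] i \<otimes> w [^] (d - i)) \<otimes> \<kappa> (coeff p i) \<otimes> z [^] (d - i)"
        using assms(2,3) by (simp add: m_assoc)
      also have "\<dots> = \<kappa> (coeff p i) \<otimes> (w [^] i \<otimes> w [^] (d - i)) \<otimes> z [^] (d - i)"
        using assms(2) by (simp add: scalar_central[of "w [^] i \<otimes> w [^] (d - i)"])
      finally show ?thesis using assms(2,3) by (simp add: m_assoc)
    qed
    have "lcong u (\<kappa> (coeff p i) \<otimes> w [^] i \<otimes> (w [^] (d - i) \<otimes> z [^] (d - i)))
        (\<kappa> (coeff p i) \<otimes> w [^] i \<otimes> \<one>)"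
      using assms(2,5) pow_lcong_one[OF assms(2-7)] by (intro lcong_lmult) auto
    then have "lcong u (\<kappa> (coeff p i) \<otimes> w [^] i \<otimes> (w [^] (d - i) \<otimes> z [^] (d - i)))
        (\<kappa> (coeff p i) \<otimes> w [^] i)"
      using assms(2) by simp
    then show ?thesis
      unfolding eq using assms(2,5) by (simp add: lcong_sym)
  qed
  have sym: "coeff p (d - i) = coeff p i" if "i \<le> d" for i
    using assms(1) that unfolding monic_palindromic_def d_def by metis
  have flip: "(\<lambda>i. d - i) ` {..d} = {..d}"
  proof (intro equalityI subsetI)
    fix i assume "i \<in> {..d}"
    then show "i \<in> (\<lambda>i. d - i) ` {..d}" by (intro image_eqI[of _ _ "d - i"]) auto
  qed auto
  \<comment> \<open>Reverse the order of summation; palindromicity restores the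
    coefficients.\<close>
  have "peval p z = (\<Oplus>i\<in>(\<lambda>i. d - i) ` {..d}. \<kappa> (coeff p i) \<otimes> z [^] i)"
    unfolding flip by (simp add: peval_def d_def)
  also have "\<dots> = (\<Oplus>i\<in>{..d}. \<kappa> (coeff p (d - i)) \<otimes> z [^] (d - i))"
    using assms(3) by (subst finsum_reindex) (auto simp: inj_on_def)
  also have "\<dots> = (\<Oplus>i\<in>{..d}. \<kappa> (coeff p i) \<otimes> z [^] (d - i))"
    using assms(3) by (intro finsum_cong') (auto simp: sym)
  finally have "w [^] d \<otimes> peval p z = (\<Oplus>i\<in>{..d}. w [^] d \<otimes> (\<kappa> (coeff p i) \<otimes> z [^] (d - i)))"
    using assms(2,3) by (simp add: finsum_rdistr Pi_def)
  moreover have "lcong u (peval p w) \<dots>"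
    unfolding peval_def d_def[symmetric] using assms(2,3,5) step by (intro lcong_finsum) auto
  ultimately show ?thesis by (simp add: d_def)
qed

end


section \<open>The recursion\<close>

text \<open>The period is \<open>K = k + 1\<close>.\<close>

locale palindromic_recursion = scalar_ring +
  fixes k :: nat and h :: "int \<Rightarrow> rat poly" and a b Y :: "int \<Rightarrow> 'a"
  assumes a_unit [simp]: "a n \<in> Units R"
    and b_unit [simp]: "b n \<in> Units R"
    and Y_unit [simp]: "Y n \<in> Units R"
    and a_shift: "a (n + int k + 1) = inv (b n)"
    and b_shift: "b (n + int k + 1) = inv (a n)"
    and palindromic: "monic_palindromic (h n)"
    and h_period: "h (n + int k + 1) = h n"
begin

lemma vars_closed [simp]:
  "a n \<in> carrier R" "b n \<in> carrier R" "Y n \<in> carrier R"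
  using a_unit b_unit Y_unit by (blast intro: Units_closed)+

text \<open>\<open>X\<^sub>n\<close> and \<open>Z\<^sub>n\<close> of the introduction are \<open>XX n k\<close> and \<open>ZZ n k\<close>.\<close>

primrec XX :: "int \<Rightarrow> nat \<Rightarrow> 'a" where
  "XX n 0 = a n"
| "XX n (Suc m) = XX n m \<otimes> Y (n + int m + 1) \<otimes> a (n + int m + 1)"

primrec ZZ :: "int \<Rightarrow> nat \<Rightarrow> 'a" where
  "ZZ n 0 = b n"
| "ZZ n (Suc m) = b (n + int m + 1) \<otimes> Y (n + int m + 1) \<otimes> ZZ n m"

lemma XX_closed [simp]: "XX n m \<in> carrier R"
  by (induction m) auto

lemma ZZ_closed [simp]: "ZZ n m \<in> carrier R"
  by (induction m) auto

text \<open>Cuts the product at one of its Y-factors. In \<open>step_forward\<close> this exposes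
  the modulus Y_{n+K} inside a longer product.\<close>

lemma XX_split: "XX n (p + q + 1) = XX n p \<otimes> Y (n + int p + 1) \<otimes> XX (n + int p + 1) q"
proof (induction q)
  case (Suc q)
  have "XX n (p + Suc q + 1) = XX n (p + q + 1) \<otimes> Y (n + int p + 1 + int q + 1) \<otimes> a (n + int p + 1 + int q + 1)"
    by (simp add: algebra_simps)
  then show ?case unfolding Suc.IH by (simp add: m_assoc)
qed (simp add: algebra_simps)

lemma XX_Suc_front: "XX n (Suc m) = a n \<otimes> Y (n + 1) \<otimes> XX (n + 1) m"
  using XX_split[of n 0 m] by simp

lemma ZZ_Suc_front: "ZZ n (Suc m) = ZZ (n + 1) m \<otimes> Y (n + 1) \<otimes> b n"
proof (induction m)
  case (Suc m)
  have "ZZ n (Suc (Suc m)) = b (n + 1 + int m + 1) \<otimes> Y (n + 1 + int m + 1) \<otimes> ZZ n (Suc m)"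
    by (simp add: algebra_simps)
  then show ?case unfolding Suc.IH by (simp add: m_assoc)
qed simp

end

section \<open>Propagation of the exchange relation\<close>

locale recursion_ring = palindromic_recursion +
  assumes recursion: "Y (n + int k + 1) \<otimes> Y n = peval (h n) (XX n k)"
begin

text \<open>X_n commutes with Y_{n+K} Y_n = h_n(X_n). So multiplying the first equation by Y_{n+K}
  on the left gives the second one multiplied by Y_n on the right, and units cancel.\<close>

lemma exchange_iff:
  "Y n \<otimes> XX n k = ZZ n k \<otimes> Y n \<longleftrightarrow> XX n k \<otimes> Y (n + int k + 1) = Y (n + int k + 1) \<otimes> ZZ n k"
proof -
  let ?Y = "Y (n + int k + 1)"
  have comm: "XX n k \<otimes> (?Y \<otimes> Y n) = ?Y \<otimes> Y n \<otimes> XX n k"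
    unfolding recursion by (rule peval_intertwine) auto
  have "Y n \<otimes> XX n k = ZZ n k \<otimes> Y n \<longleftrightarrow> ?Y \<otimes> (Y n \<otimes> XX n k) = ?Y \<otimes> (ZZ n k \<otimes> Y n)"
    by simp
  also have "\<dots> \<longleftrightarrow> (XX n k \<otimes> ?Y) \<otimes> Y n = (?Y \<otimes> ZZ n k) \<otimes> Y n"
    using comm by (simp add: m_assoc)
  also have "\<dots> \<longleftrightarrow> XX n k \<otimes> ?Y = ?Y \<otimes> ZZ n k"
    by (simp add: Units_r_cancel)
  finally show ?thesis .
qed

text \<open>Since a_{n+K} and b_{n+K} are the inverses of b_n and a_n, each side of the second
  equation is a_n (...) b_n around the corresponding side of the first.\<close>

lemma exchange_shift_iff:
  "Y (n + 1) \<otimes> XX (n + 1) k = ZZ (n + 1) k \<otimes> Y (n + 1) \<longleftrightarrow>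
    XX n k \<otimes> Y (n + int k + 1) = Y (n + int k + 1) \<otimes> ZZ n k"
proof -
  let ?Y = "Y (n + int k + 1)"
  have X: "XX n k \<otimes> ?Y = a n \<otimes> (Y (n + 1) \<otimes> XX (n + 1) k) \<otimes> b n"
  proof -
    have "XX n (Suc k) = a n \<otimes> Y (n + 1) \<otimes> XX (n + 1) k" by (rule XX_Suc_front)
    then have "XX n k \<otimes> ?Y \<otimes> a (n + int k + 1) \<otimes> b n = a n \<otimes> Y (n + 1) \<otimes> XX (n + 1) k \<otimes> b n"
      by simp
    then show ?thesis by (simp add: m_assoc a_shift)
  qed
  have Z: "?Y \<otimes> ZZ n k = a n \<otimes> (ZZ (n + 1) k \<otimes> Y (n + 1)) \<otimes> b n"
  proof -
    have "ZZ n (Suc k) = ZZ (n + 1) k \<otimes> Y (n + 1) \<otimes> b n" by (rule ZZ_Suc_front)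
    then have "a n \<otimes> (b (n + int k + 1) \<otimes> ?Y \<otimes> ZZ n k) = a n \<otimes> (ZZ (n + 1) k \<otimes> Y (n + 1) \<otimes> b n)"
      by simp
    moreover have "a n \<otimes> (b (n + int k + 1) \<otimes> ?Y \<otimes> ZZ n k) = (a n \<otimes> b (n + int k + 1)) \<otimes> (?Y \<otimes> ZZ n k)"
      by (simp add: m_assoc)
    ultimately show ?thesis by (simp add: m_assoc b_shift)
  qed
  show ?thesis
    unfolding X Z by (simp add: Units_r_cancel)
qed

text \<open>The two equivalences share their right-hand side, so chaining them moves the relation by
  one index in either direction.\<close>

lemma exchange_all:
  assumes "Y m \<otimes> XX m k = ZZ m k \<otimes> Y m"
  shows "Y n \<otimes> XX n k = ZZ n k \<otimes> Y n"
proof (induction n rule: int_induct[where k = m])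
  case base
  show ?case by (fact assms)
next
  case (step1 i)
  then show ?case using exchange_iff[of i] exchange_shift_iff[of i] by blast
next
  case (step2 i)
  then show ?case using exchange_iff[of "i - 1"] exchange_shift_iff[of "i - 1"] by simp
qed

end

section \<open>Laurent property from the exchange relation\<close>

locale exchange_ring = recursion_ring +
  assumes exchange: "Y n \<otimes> XX n k = ZZ n k \<otimes> Y n"
begin

lemma exchange': "XX n k \<otimes> Y (n + int k + 1) = Y (n + int k + 1) \<otimes> ZZ n k"
  using exchange exchange_iff by blast

lemma recursion': "Y n \<otimes> Y (n + int k + 1) = peval (h n) (ZZ n k)"
proof -
  have "(Y n \<otimes> Y (n + int k + 1)) \<otimes> Y n = Y n \<otimes> peval (h n) (XX n k)"
    by (simp add: m_assoc flip: recursion)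
  also have "\<dots> = peval (h n) (ZZ n k) \<otimes> Y n"
    by (rule peval_intertwine) (auto simp: exchange)
  finally show ?thesis
    by (simp add: Units_r_cancel)
qed

lemma step_forward:
  assumes "scalar_subring R \<kappa> B"
    and aB [simp]: "\<And>n. a n \<in> B" and bB [simp]: "\<And>n. b n \<in> B"
    and YB: "\<And>j. n \<le> j \<Longrightarrow> j < n + 2 * (int k + 1) \<Longrightarrow> Y j \<in> B"
  shows "Y (n + 2 * (int k + 1)) \<in> B"
proof -
  interpret scalar_subring R \<kappa> B by fact
  define K where "K = int k + 1"
  define u where "u = Y (n + K)"
  have u: "u \<in> carrier R" "u \<in> B" by (auto simp: u_def K_def intro: YB)
  \<comment> \<open>The product involves only Y_{j+1}, ..., Y_{j+m}, hence the bound n \<le> j + 1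
    rather than n \<le> j.\<close>
  have XB: "XX j m \<in> B" if "n \<le> j + 1" "j + int m < n + 2 * K" for j m
    using that
  proof (induction m)
    case (Suc m)
    then have "Y (j + int m + 1) \<in> B" by (intro YB) (auto simp: K_def)
    then show ?case using Suc by simp
  qed simp
  have ZB: "ZZ j m \<in> B" if "n \<le> j + 1" "j + int m < n + 2 * K" for j m
    using that
  proof (induction m)
    case (Suc m)
    then have "Y (j + int m + 1) \<in> B" by (intro YB) (auto simp: K_def)
    then show ?case using Suc by simp
  qed simp
  have V: "lcong u (XX (n + K) j \<otimes> ZZ n j) \<one>" if "j \<le> k" for j
    using that
  proof (induction j)
    case 0
    have "XX (n + K) 0 \<otimes> ZZ n 0 = \<one>"
      using a_shift[of n] by (simp add: K_def add.assoc)
    then show ?case using u by (simp add: lcong_refl)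
  next
    case (Suc j)
    let ?n = "n + int j + 1"
    obtain r where r: "r \<in> B" "peval (h ?n) (XX ?n k) = \<one> \<oplus> r \<otimes> XX ?n k"
    proof -
      \<comment> \<open>Palindromicity at index 0 equates the constant term with the leading
        coefficient.\<close>
      have "coeff (h ?n) 0 = 1"
        using palindromic[of ?n] unfolding monic_palindromic_def by (metis diff_zero le0)
      moreover have "XX ?n k \<in> B"
        using Suc.prems by (intro XB) (auto simp: K_def)
      ultimately show ?thesis
        using peval_lcong_one that unfolding lcong_def by blast
    qed
    \<comment> \<open>The part of X_{n+j+1} after its factor Y_{n+K} is exactly
      \<open>XX (n + K) j\<close>. Hence \<open>XX (n + K) j \<otimes> ZZ n j\<close>, known from
      the induction hypothesis, reappears to the right of \<open>u\<close> in the error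
      term.\<close>
    have split: "XX ?n k = XX ?n (k - Suc j) \<otimes> u \<otimes> XX (n + K) j"
    proof -
      have "k - Suc j + j + 1 = k" "?n + int (k - Suc j) + 1 = n + K"
        using Suc.prems by (simp_all add: K_def)
      then show ?thesis using XX_split[of ?n "k - Suc j" j] unfolding u_def by metis
    qed
    have cancel: "a (n + K + int j + 1) \<otimes> b ?n = \<one>"
    proof -
      have "n + K + int j + 1 = ?n + int k + 1" by (simp add: K_def)
      then have "a (n + K + int j + 1) = inv (b ?n)" using a_shift by metis
      then show ?thesis by simp
    qed
    have rec: "Y (n + K + int j + 1) \<otimes> Y ?n = \<one> \<oplus> r \<otimes> XX ?n k"
    proof -
      have "n + K + int j + 1 = ?n + int k + 1" by (simp add: K_def)
      then show ?thesis using recursion[of ?n] r(2) by metis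
    qed
    have "XX (n + K) (Suc j) \<otimes> ZZ n (Suc j)
        = XX (n + K) j \<otimes> Y (n + K + int j + 1) \<otimes> (a (n + K + int j + 1) \<otimes> b ?n) \<otimes> Y ?n \<otimes> ZZ n j"
      by (simp add: m_assoc)
    also have "\<dots> = XX (n + K) j \<otimes> (Y (n + K + int j + 1) \<otimes> Y ?n) \<otimes> ZZ n j"
      unfolding cancel by (simp add: m_assoc)
    also have "\<dots> = XX (n + K) j \<otimes> ZZ n j
        \<oplus> (XX (n + K) j \<otimes> r \<otimes> XX ?n (k - Suc j) \<otimes> u) \<otimes> (XX (n + K) j \<otimes> ZZ n j)"
      unfolding rec split using r(1) u by (simp add: l_distr r_distr m_assoc)
    finally have eq: "XX (n + K) (Suc j) \<otimes> ZZ n (Suc j) = \<dots>" .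
    obtain s where s: "s \<in> B" "XX (n + K) j \<otimes> ZZ n j = \<one> \<oplus> s \<otimes> u"
      using Suc unfolding lcong_def by auto
    define q where "q = XX (n + K) j \<otimes> r \<otimes> XX ?n (k - Suc j)"
    have q: "q \<in> B"
      unfolding q_def using r(1) Suc.prems by (intro B_closed XB) (auto simp: K_def)
    have "XX (n + K) (Suc j) \<otimes> ZZ n (Suc j) = (\<one> \<oplus> s \<otimes> u) \<oplus> (q \<otimes> u) \<otimes> (\<one> \<oplus> s \<otimes> u)"
      unfolding eq s(2) q_def ..
    \<comment> \<open>Here u (1 + s u) = (1 + u s) u keeps the error a left multiple of
      \<open>u\<close>.\<close>
    also have "\<dots> = \<one> \<oplus> (s \<oplus> q \<oplus> q \<otimes> u \<otimes> s) \<otimes> u"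
      using q s(1) u by (simp add: l_distr r_distr m_assoc a_assoc)
    finally show ?case
      using q s(1) u by (intro lcongI) auto
  qed
  let ?W = "XX (n + K) k" and ?Z = "ZZ n k" and ?d = "degree (h n)"
  have WB: "?W \<in> B" by (intro XB) (auto simp: K_def)
  \<comment> \<open>The element intertwined with Z_n by \<open>u\<close> is X_n, by
    \<open>exchange'\<close>.\<close>
  have "lcong u (peval (h n) ?W) (?W [^] ?d \<otimes> peval (h n) ?Z)"
  proof (rule peval_lcong_reflect[OF palindromic])
    show "?W \<in> B" by (fact WB)
    show "?Z \<in> B" "XX n k \<in> B" by (intro ZB XB; simp add: K_def)+
    show "u \<otimes> ?Z = XX n k \<otimes> u" using exchange'[of n] by (simp add: u_def K_def add.assoc)
    show "lcong u (?W \<otimes> ?Z) \<one>" by (rule V) simp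
  qed (fact u)
  then obtain r where r: "r \<in> B" "peval (h n) ?W = ?W [^] ?d \<otimes> peval (h n) ?Z \<oplus> r \<otimes> u"
    unfolding lcong_def by blast
  have "peval (h n) ?Z = Y n \<otimes> u"
    using recursion'[of n] by (simp add: u_def K_def add.assoc)
  then have "peval (h n) ?W = (?W [^] ?d \<otimes> Y n \<oplus> r) \<otimes> u"
    unfolding r(2) using r(1) u by (simp add: l_distr m_assoc)
  moreover have "peval (h n) ?W = Y (n + 2 * K) \<otimes> u"
    using recursion[of "n + K"] h_period[of n] by (simp add: u_def K_def algebra_simps)
  \<comment> \<open>\<open>u\<close> is a unit of R and can be cancelled on the right, although its
    inverse is not assumed to lie in \<open>B\<close>. The remaining expression uses only elements
    of \<open>B\<close>.\<close>
  ultimately have "Y (n + 2 * K) \<otimes> u = (?W [^] ?d \<otimes> Y n \<oplus> r) \<otimes> u" by simp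
  moreover have "u \<in> Units R" by (simp add: u_def)
  ultimately have "Y (n + 2 * K) = ?W [^] ?d \<otimes> Y n \<oplus> r"
    using r(1) by (simp add: Units_r_cancel)
  also have "\<dots> \<in> B"
    using r(1) WB YB[of n] by (intro B_closed B_pow) auto
  finally show ?thesis by (simp add: K_def)
qed

text \<open>Reflection turns X_n into Z_{-n-K} and Z_n into X_{-n-K}, so \<open>recursion'\<close>
  and \<open>exchange'\<close> become the recursion and the exchange relation. In Z the letter right
  after Y_{m+1} is b_m, which forces the index shift in b_{-n-1}.\<close>

lemma exchange_ring_reflect:
  "exchange_ring R \<kappa> k (\<lambda>n. h (- n - int k - 1)) (\<lambda>n. b (- n - 1)) (\<lambda>n. a (- n - 1)) (\<lambda>n. Y (- n))"
proof -
  interpret R: palindromic_recursion R \<kappa> k "\<lambda>n. h (- n - int k - 1)"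
      "\<lambda>n. b (- n - 1)" "\<lambda>n. a (- n - 1)" "\<lambda>n. Y (- n)"
  proof unfold_locales
    show "b (- (n + int k + 1) - 1) = inv a (- n - 1)" for n
    proof -
      have "- (n + int k + 1) - 1 + int k + 1 = - n - 1" by simp
      then have "a (- n - 1) = inv b (- (n + int k + 1) - 1)" using a_shift by metis
      then show ?thesis by simp
    qed
    show "a (- (n + int k + 1) - 1) = inv b (- n - 1)" for n
    proof -
      have "- (n + int k + 1) - 1 + int k + 1 = - n - 1" by simp
      then have "b (- n - 1) = inv a (- (n + int k + 1) - 1)" using b_shift by metis
      then show ?thesis by simp
    qed
    show "h (- (n + int k + 1) - int k - 1) = h (- n - int k - 1)" for n
    proof -
      have "- (n + int k + 1) - int k - 1 + int k + 1 = - n - int k - 1" by simp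
      then show ?thesis using h_period by metis
    qed
  qed (auto simp: palindromic)
  have X: "R.XX n m = ZZ (- n - int m - 1) m" for n m
  proof (induction m arbitrary: n)
    case (Suc m)
    let ?j = "- n - int (Suc m) - 1"
    have "?j + 1 = - n - int m - 1" "?j + 1 = - (n + int m + 1)" "?j = - (n + int m + 1) - 1"
      by simp_all
    then show ?case
      using ZZ_Suc_front[of ?j m] unfolding R.XX.simps Suc.IH by metis
  qed simp
  have Z: "R.ZZ n m = XX (- n - int m - 1) m" for n m
  proof (induction m arbitrary: n)
    case (Suc m)
    let ?j = "- n - int (Suc m) - 1"
    have "?j + 1 = - n - int m - 1" "?j + 1 = - (n + int m + 1)" "?j = - (n + int m + 1) - 1"
      by simp_all
    then show ?case
      using XX_Suc_front[of ?j m] unfolding R.ZZ.simps Suc.IH by metis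
  qed simp
  show ?thesis
  proof unfold_locales
    show "Y (- (n + int k + 1)) \<otimes> Y (- n) = peval (h (- n - int k - 1)) (R.XX n k)" for n
    proof -
      have "- n - int k - 1 + int k + 1 = - n" "- n - int k - 1 = - (n + int k + 1)" by simp_all
      then show ?thesis using recursion'[of "- n - int k - 1"] unfolding X by metis
    qed
    show "Y (- n) \<otimes> R.XX n k = R.ZZ n k \<otimes> Y (- n)" for n
      unfolding X Z using exchange'[of "- n - int k - 1"] by (simp add: algebra_simps)
  qed
qed

lemma step_backward:
  assumes "scalar_subring R \<kappa> B"
    and "\<And>n. a n \<in> B" "\<And>n. b n \<in> B"
    and YB: "\<And>j. n < j \<Longrightarrow> j \<le> n + 2 * (int k + 1) \<Longrightarrow> Y j \<in> B"
  shows "Y n \<in> B"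
proof -
  interpret R: exchange_ring R \<kappa> k "\<lambda>n. h (- n - int k - 1)"
      "\<lambda>n. b (- n - 1)" "\<lambda>n. a (- n - 1)" "\<lambda>n. Y (- n)"
    by (rule exchange_ring_reflect)
  \<comment> \<open>The reflected window starting at -n-2K consists of Y_{n+1}, ...,
    Y_{n+2K}.\<close>
  have "Y (- (- n - 2 * (int k + 1) + 2 * (int k + 1))) \<in> B"
    by (rule R.step_forward) (use assms in auto)
  then show ?thesis by simp
qed

text \<open>Inverses of initial variables enter only for K < j \<le> 2K, through Y_{i+K} = h_i(X_i)
  Y_i^{-1}. Beyond that, and below 1, a full window of 2K consecutive variables is
  available.\<close>

lemma Y_in_initial_subring:
  assumes "scalar_subring R \<kappa> B"
    and aB [simp]: "\<And>n. a n \<in> B" and bB: "\<And>n. b n \<in> B"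
    and init: "\<And>j. 1 \<le> j \<Longrightarrow> j \<le> int k + 1 \<Longrightarrow> Y j \<in> B \<and> inv (Y j) \<in> B"
  shows "Y n \<in> B"
proof -
  interpret scalar_subring R \<kappa> B by fact
  have pos: "1 \<le> j \<Longrightarrow> Y j \<in> B" for j
  proof (induction "nat j" arbitrary: j rule: less_induct)
    case less
    have IH: "Y i \<in> B" if "1 \<le> i" "i < j" for i
      using less.hyps[of i] that by simp
    consider "j \<le> int k + 1" | "int k + 1 < j" "j \<le> 2 * (int k + 1)" | "2 * (int k + 1) < j" by linarith
    then show ?case
    proof cases
      case 1
      then show ?thesis using init less.prems by blast
    next
      case 2
      define i where "i = j - int k - 1"
      have i: "1 \<le> i" "i \<le> int k + 1" "j = i + int k + 1" using 2 by (simp_all add: i_def)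
      have "XX i m \<in> B" if "m \<le> k" for m
        using that
      proof (induction m)
        case (Suc m)
        then have "Y (i + int m + 1) \<in> B" using i by (intro IH) auto
        then show ?case using Suc by simp
      qed simp
      then have "peval (h i) (XX i k) \<otimes> inv (Y i) \<in> B"
        using init i by auto
      moreover have "peval (h i) (XX i k) \<otimes> inv (Y i) = Y j"
        unfolding recursion[symmetric] using i by (simp add: m_assoc)
      ultimately show ?thesis by simp
    next
      case 3
      have "Y (j - 2 * (int k + 1) + 2 * (int k + 1)) \<in> B"
        using 3 by (intro step_forward assms IH) auto
      then show ?thesis by simp
    qed
  qed
  \<comment> \<open>Proving the claim for all j \<ge> n at once supplies the window for
    \<open>step_backward\<close>.\<close>
  have "n \<le> j \<Longrightarrow> Y j \<in> B" for j
  proof (induction "nat (1 - n)" arbitrary: n j)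
    case 0
    then show ?case by (intro pos) simp
  next
    case (Suc m)
    have IH: "Y j \<in> B" if "n < j" for j
      using Suc.hyps(1)[of "n + 1" j] Suc.hyps(2) that by force
    show ?case
    proof (cases "j = n")
      case True
      then show ?thesis using step_backward[of B] assms(1) aB bB IH by auto
    qed (use IH Suc.prems in auto)
  qed
  then show ?thesis by simp
qed

end


section \<open>The presented algebra\<close>

text \<open>For a single word this holds because the empty word is neutral and rationals commute;
  finite support gives the general case.\<close>

lemma nc_const_central: "nc_const c * p = p * nc_const c"
proof (induction p rule: update_induct)
  case const
  show ?case by simp
next
  case (update p w d)
  have "Poly_Mapping.update w d p = p + Poly_Mapping.single w d"
    using update(1)
    by (intro poly_mapping_eqI) (auto simp: lookup_update lookup_add lookup_single when_def in_keys_iff)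
  then show ?case
    using update by (simp add: nc_const_def mult_single mult.commute algebra_simps)
qed

context
  fixes K :: nat and h :: "int \<Rightarrow> rat poly"
  assumes K: "K > 0"
begin

interpretation F: ring "F_alg K h"
  by (rule F_alg_ring[OF K])

lemma F_class_closed: "p \<in> carrier (free_algebra (alphabet K)) \<Longrightarrow> F_class K h p \<in> carrier (F_alg K h)"
  by (rule ring_hom_closed[OF F_class_hom[OF K]])

lemma F_class_one: "F_class K h 1 = \<one>\<^bsub>F_alg K h\<^esub>"
  using ring_hom_one[OF F_class_hom[OF K]] by (simp add: free_algebra_def)

lemma F_class_mult:
  "p \<in> carrier (free_algebra (alphabet K)) \<Longrightarrow> q \<in> carrier (free_algebra (alphabet K)) \<Longrightarrow>
    F_class K h (p * q) = F_class K h p \<otimes>\<^bsub>F_alg K h\<^esub> F_class K h q"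
  using ring_hom_mult[OF F_class_hom[OF K]] by (simp add: free_algebra_def)

lemma F_class_add:
  "p \<in> carrier (free_algebra (alphabet K)) \<Longrightarrow> q \<in> carrier (free_algebra (alphabet K)) \<Longrightarrow>
    F_class K h (p + q) = F_class K h p \<oplus>\<^bsub>F_alg K h\<^esub> F_class K h q"
  using ring_hom_add[OF F_class_hom[OF K]] by (simp add: free_algebra_def)

lemma F_scalar_ring: "scalar_ring (F_alg K h) (\<lambda>c. F_class K h (nc_const c))"
proof unfold_locales
  show "F_class K h (nc_const c) \<in> carrier (F_alg K h)" for c
    by (intro F_class_closed carrier_closed)
  show "F_class K h (nc_const 1) = \<one>\<^bsub>F_alg K h\<^esub>"
    using F_class_one by (simp add: nc_const_def)
  show "F_class K h (nc_const c) \<otimes>\<^bsub>F_alg K h\<^esub> x = x \<otimes>\<^bsub>F_alg K h\<^esub> F_class K h (nc_const c)"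
    if x: "x \<in> carrier (F_alg K h)" for x c
  proof -
    obtain p where "p \<in> carrier (free_algebra (alphabet K))" "x = F_class K h p"
      using x unfolding F_alg_def F_class_def FactRing_def A_RCOSETS_def' by auto
    then show ?thesis
      by (simp add: carrier_closed nc_const_central flip: F_class_mult)
  qed
qed

interpretation F: scalar_ring "F_alg K h" "\<lambda>c. F_class K h (nc_const c)"
  by (rule F_scalar_ring)

lemma F_class_power:
  assumes z: "z \<in> carrier (free_algebra (alphabet K))"
  shows "z ^ i \<in> carrier (free_algebra (alphabet K)) \<and>
    F_class K h (z ^ i) = F_class K h z [^]\<^bsub>F_alg K h\<^esub> i"
  using z by (induction i) (simp_all add: carrier_closed F_class_one F_class_mult power_Suc2 del: power_Suc)

lemma F_class_nc_eval:
  assumes z: "z \<in> carrier (free_algebra (alphabet K))"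
  shows "F_class K h (nc_eval p z) = F.peval p (F_class K h z)"
proof -
  have "(\<Sum>i\<le>m. nc_const (coeff p i) * z ^ i) \<in> carrier (free_algebra (alphabet K)) \<and>
    F_class K h (\<Sum>i\<le>m. nc_const (coeff p i) * z ^ i) =
      (\<Oplus>\<^bsub>F_alg K h\<^esub>i\<in>{..m}. F_class K h (nc_const (coeff p i)) \<otimes>\<^bsub>F_alg K h\<^esub> F_class K h z [^]\<^bsub>F_alg K h\<^esub> i)" for m
  proof (induction m)
    case 0
    then show ?case
      using z by (simp add: carrier_closed F_class_closed F_class_mult F_class_one)
  next
    case (Suc m)
    have c: "nc_const (coeff p (Suc m)) * z ^ Suc m \<in> carrier (free_algebra (alphabet K))"
      "F_class K h (nc_const (coeff p (Suc m)) * z ^ Suc m) =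
        F_class K h (nc_const (coeff p (Suc m))) \<otimes>\<^bsub>F_alg K h\<^esub> F_class K h z [^]\<^bsub>F_alg K h\<^esub> Suc m"
      using F_class_power[OF z, of "Suc m"] by (simp_all add: carrier_closed F_class_mult del: power_Suc)
    have "(\<Oplus>\<^bsub>F_alg K h\<^esub>i\<in>{..Suc m}. F_class K h (nc_const (coeff p i)) \<otimes>\<^bsub>F_alg K h\<^esub> F_class K h z [^]\<^bsub>F_alg K h\<^esub> i) =
        F_class K h (nc_const (coeff p (Suc m)) * z ^ Suc m) \<oplus>\<^bsub>F_alg K h\<^esub> F_class K h (\<Sum>i\<le>m. nc_const (coeff p i) * z ^ i)"
      unfolding c(2) using Suc z
      by (simp add: F.finsum_Suc Pi_def F_class_closed del: F.nat_pow_Suc)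
    also have "\<dots> = F_class K h ((\<Sum>i\<le>m. nc_const (coeff p i) * z ^ i) + nc_const (coeff p (Suc m)) * z ^ Suc m)"
      using F_class_add[OF conjunct1[OF Suc] c(1)] by (simp only: F.a_comm[OF F_class_closed[OF c(1)] F_class_closed[OF conjunct1[OF Suc]]])
    finally show ?case
      using carrier_closed(2)[OF conjunct1[OF Suc] c(1)] by (simp del: power_Suc F.nat_pow_Suc)
  qed
  then show ?thesis unfolding nc_eval_def F.peval_def by blast
qed

end

text \<open>The defining relation gives the exchange relation at n = 1 only;
  \<open>exchange_all\<close> supplies every other index.\<close>

lemma F_exchange_ring:
  assumes K: "K = k + 1"
    and pal: "\<And>m. monic_palindromic (h m)"
    and per: "\<And>m. h m = h (m - int K)"
  shows "exchange_ring (F_alg K h) (\<lambda>c. F_class K h (nc_const c)) k h (F_a K h) (F_b K h) (F_Y K h)"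
proof -
  have K0: "K > 0" using K by simp
  have shift: "n + int k + 1 = n + int K" for n using K by simp
  note closed = carrier_closed prod_list_closed var_closed[OF K0]
  interpret scalar_ring "F_alg K h" "\<lambda>c. F_class K h (nc_const c)"
    by (rule F_scalar_ring[OF K0])
  have Y: "Pos (GenY n) \<in> alphabet K" for n
    by (simp add: alphabet_def gens_def)
  interpret palindromic_recursion "F_alg K h" "\<lambda>c. F_class K h (nc_const c)" k h
      "F_a K h" "F_b K h" "F_Y K h"
  proof (unfold_locales, goal_cases)
    case (1 n)
    show ?case unfolding F_a_def a_var_def by (intro F_inverse K0 letter_in_alphabet)
  next
    case (2 n)
    show ?case unfolding F_b_def b_var_def by (intro F_inverse K0 letter_in_alphabet)
  next
    case (3 n)
    show ?case unfolding F_Y_def Y_var_def by (intro F_inverse K0 Y)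
  next
    case (4 n)
    show ?case unfolding shift by (rule F_shift(1)[OF K0])
  next
    case (5 n)
    show ?case unfolding shift by (rule F_shift(2)[OF K0])
  next
    case (6 n)
    show ?case by (rule pal)
  next
    case (7 n)
    show ?case unfolding shift using per[of "n + int K"] by simp
  qed
  have XX: "XX n m = F_class K h (a_var K n * prod_list (map (\<lambda>j. Y_var j * a_var K j) [n + 1..n + int m]))" for n m
  proof (induction m)
    case 0
    show ?case unfolding XX.simps by (simp add: F_a_def)
  next
    case (Suc m)
    let ?f = "\<lambda>j. Y_var j * a_var K j" and ?i = "n + int m + 1"
    have "[n + 1..n + int (Suc m)] = [n + 1..n + int m] @ [?i]"
      using upto_rec2[of "n + 1" "n + int (Suc m)"] by (simp add: algebra_simps)
    then have "a_var K n * prod_list (map ?f [n + 1..n + int (Suc m)]) =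
        a_var K n * prod_list (map ?f [n + 1..n + int m]) * Y_var ?i * a_var K ?i"
      by (simp add: mult.assoc)
    then show ?case
      unfolding XX.simps Suc.IH unfolding F_a_def F_Y_def by (simp only: F_class_mult[OF K0] closed)
  qed
  \<comment> \<open>\<open>ZZ n m\<close> ends in b_n; the extra Y_n completes the last pair b_n
    Y_n, matching the right side of the defining relation.\<close>
  have ZZ: "ZZ n m \<otimes>\<^bsub>F_alg K h\<^esub> F_Y K h n =
      F_class K h (prod_list (map (\<lambda>j. b_var K j * Y_var j) (rev [n..n + int m])))" for n m
  proof (induction m)
    case 0
    show ?case unfolding ZZ.simps by (simp add: F_b_def F_Y_def F_class_mult[OF K0] closed)
  next
    case (Suc m)
    let ?f = "\<lambda>j. b_var K j * Y_var j" and ?i = "n + int m + 1"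
    have "[n..n + int (Suc m)] = [n..n + int m] @ [?i]"
      using upto_rec2[of n "n + int (Suc m)"] by (simp add: algebra_simps)
    then have "prod_list (map ?f (rev [n..n + int (Suc m)])) =
        b_var K ?i * Y_var ?i * prod_list (map ?f (rev [n..n + int m]))"
      by (simp add: mult.assoc)
    moreover have "ZZ n (Suc m) \<otimes>\<^bsub>F_alg K h\<^esub> F_Y K h n =
        F_b K h ?i \<otimes>\<^bsub>F_alg K h\<^esub> F_Y K h ?i \<otimes>\<^bsub>F_alg K h\<^esub> (ZZ n m \<otimes>\<^bsub>F_alg K h\<^esub> F_Y K h n)"
      by (simp add: m_assoc)
    ultimately show ?case
      unfolding Suc.IH unfolding F_b_def F_Y_def by (simp only: F_class_mult[OF K0] closed)
  qed
  interpret recursion_ring "F_alg K h" "\<lambda>c. F_class K h (nc_const c)" k h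
      "F_a K h" "F_b K h" "F_Y K h"
  proof
    fix n
    have bound: "n + int K - 1 = n + int k" using K by simp
    show "F_Y K h (n + int k + 1) \<otimes>\<^bsub>F_alg K h\<^esub> F_Y K h n = peval (h n) (XX n k)"
      unfolding shift F_recursion[OF K0] XX bound by (simp add: F_class_nc_eval[OF K0] closed)
  qed
  show ?thesis
  proof
    have "F_Y K h 1 \<otimes>\<^bsub>F_alg K h\<^esub> XX 1 k =
        F_class K h (prod_list (map (\<lambda>j. Y_var j * a_var K j) [1..int K]))"
    proof -
      have "[1..int K] = 1 # [1 + 1..1 + int k]"
        using upto_rec1[of 1 "int K"] K by (simp add: add.commute)
      then have "prod_list (map (\<lambda>j. Y_var j * a_var K j) [1..int K]) =
          Y_var 1 * (a_var K 1 * prod_list (map (\<lambda>j. Y_var j * a_var K j) [1 + 1..1 + int k]))"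
        by (simp add: mult.assoc)
      then show ?thesis
        unfolding XX unfolding F_Y_def by (simp only: F_class_mult[OF K0] closed)
    qed
    also have "\<dots> = ZZ 1 k \<otimes>\<^bsub>F_alg K h\<^esub> F_Y K h 1"
      unfolding F_exchange[OF K0] ZZ using K by (simp add: add.commute)
    finally show "F_Y K h n \<otimes>\<^bsub>F_alg K h\<^esub> XX n k = ZZ n k \<otimes>\<^bsub>F_alg K h\<^esub> F_Y K h n" for n
      by (rule exchange_all)
  qed
qed

theorem mainTheorem2:
  fixes K :: nat and h :: "int \<Rightarrow> rat poly" and n :: int
  assumes "K \<ge> 2"
    and "\<And>m. monic_palindromic (h m)"
    and "\<And>m. h m = h (m - int K)"
  shows "F_Y K h n \<in>
    F_subalgebra K h
      (\<Union>i\<in>{1..int K}.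
        {F_a K h i, inv\<^bsub>F_alg K h\<^esub> F_a K h i,
         F_b K h i, inv\<^bsub>F_alg K h\<^esub> F_b K h i,
         F_Y K h i, inv\<^bsub>F_alg K h\<^esub> F_Y K h i})"
    (is "_ \<in> F_subalgebra K h ?S")
proof -
  define k where "k = K - 1"
  have K: "K = k + 1" "K > 0" using assms(1) by (simp_all add: k_def)
  interpret exchange_ring "F_alg K h" "\<lambda>c. F_class K h (nc_const c)" k h
      "F_a K h" "F_b K h" "F_Y K h"
    by (rule F_exchange_ring) (fact K(1) assms(2,3))+
  define B where "B = F_subalgebra K h ?S"
  have S: "x \<in> B" if "x \<in> ?S" for x
    unfolding B_def F_subalgebra_def using that by (intro generate_ring.incl) blast
  \<comment> \<open>Every a_m and b_m is, up to inversion, a generator with index r in 1, ..., K, so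
    these four letters cover all integer indices.\<close>
  have letters: "F_class K h (nc_var x) \<in> B"
    if "x = Pos (GenA r) \<or> x = Neg (GenA r) \<or> x = Pos (GenB r) \<or> x = Neg (GenB r)" "r \<in> {1..int K}" for x r
  proof -
    have "F_a K h r = F_class K h (nc_var (Pos (GenA r)))" "F_b K h r = F_class K h (nc_var (Pos (GenB r)))"
      using that(2) by (simp_all add: F_a_def F_b_def a_var_def b_var_def letter_init)
    moreover from this have "inv\<^bsub>F_alg K h\<^esub> F_a K h r = F_class K h (nc_var (Neg (GenA r)))"
        "inv\<^bsub>F_alg K h\<^esub> F_b K h r = F_class K h (nc_var (Neg (GenB r)))"
      using that(2) by (simp_all add: F_inverse[OF K(2)] alphabet_def gens_def)
    moreover have "F_a K h r \<in> B" "inv\<^bsub>F_alg K h\<^esub> F_a K h r \<in> B"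
        "F_b K h r \<in> B" "inv\<^bsub>F_alg K h\<^esub> F_b K h r \<in> B"
      using that(2) by (auto intro!: S UN_I[of r])
    ultimately show ?thesis using that(1) by auto
  qed
  have range: "(m - 1) mod int K + 1 \<in> {1..int K}" for m
    using K(2) pos_mod_bound[of "int K" "m - 1"] by (simp add: add1_zle_eq)
  show ?thesis
    unfolding B_def[symmetric]
  proof (rule Y_in_initial_subring)
    show "scalar_subring (F_alg K h) (\<lambda>c. F_class K h (nc_const c)) B"
    proof (intro scalar_subring.intro scalar_subring_axioms.intro scalar_ring_axioms)
      have "F_class K h ` range nc_const \<union> ?S \<subseteq> carrier (F_alg K h)"
        by auto
      then show "subring B (F_alg K h)"
        unfolding B_def F_subalgebra_def by (intro generate_ring_is_subring) (simp add: image_image)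
      show "F_class K h (nc_const c) \<in> B" for c
        unfolding B_def F_subalgebra_def by (intro generate_ring.incl) blast
    qed
    show "F_a K h m \<in> B" for m
      unfolding F_a_def a_var_def by (rule letters[OF _ range[of m]]) (simp add: a_letter_def Let_def)
    show "F_b K h m \<in> B" for m
      unfolding F_b_def b_var_def by (rule letters[OF _ range[of m]]) (simp add: b_letter_def Let_def)
    show "F_Y K h j \<in> B \<and> inv\<^bsub>F_alg K h\<^esub> F_Y K h j \<in> B" if "1 \<le> j" "j \<le> int k + 1" for j
      using that K(1) by (intro conjI S UN_I[of j]) auto
  qed
qed

end
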